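(* Let $r\ge2$ be an integer, $Q$ be an $r$-graph, and $\mathcal{F}$ be a family of $r$-graphs with $\pi_{\mathrm{inj}}(Q,\mathcal{F})>0$. Let $\mathfrak{H}$ be a hereditary family of $\mathcal{F}$-free $r$-graphs. Suppose that $\mathcal{F}$ is $Q$-edge-stable and $Q$-vertex-extendable with respect to $\mathfrak{H}$. Then $\mathcal{F}$ is $Q$-degree-stable with respect to $\mathfrak{H}$.
   Context: An $r$-graph is a set of $r$-subsets of a finite vertex set. A homomorphism $Q\to\mathcal{H}$ is a map $V(Q)\to V(\mathcal{H})$ sending edges to edges; $\mathrm{inj}(Q,\mathcal{H})$ counts injective homomorphisms; $d_{Q,\mathcal{H}}(v)$ counts injective homomorphisms $\phi$ with $v\in\phi(V(Q))$; $\delta_Q(\mathcal{H})$ is its minimum over vertices. $\mathcal{H}$ is $\mathcal{F}$-free if it contains no member of $\mathcal{F}$ as a subgraph; $\mathrm{inj}(n,Q,\mathcal{F})=\max\{\mathrm{inj}(Q,\mathcal{H}):v(\mathcal{H})=n,\ \mathcal{H}\ \mathcal{F}\text{-free}\}$, $\pi_{\mathrm{inj}}(Q,\mathcal{F})=\lim_{n\to\infty}\mathrm{inj}(n,Q,\mathcal{F})/n^{v(Q)}$. Hereditary: closed under (not necessarily induced) subgraphs. $\mathcal{H}-v$ deletes $v$ and its edges. With respect to $\mathfrak{H}$: $\mathcal{F}$ is $Q$-edge-stable if for every $\varepsilon>0$ there exist $\delta>0,N_0$ such that every $\mathcal{F}$-free $\mathcal{H}$ on $n\ge N_0$ vertices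 with $\mathrm{inj}(Q,\mathcal{H})\ge(1-\delta)\mathrm{inj}(n,Q,\mathcal{F})$ lies in $\mathfrak{H}$ after removing at most $\varepsilon n^r$ edges; $Q$-degree-stable if there are $\varepsilon>0,N_0$ such that every $\mathcal{F}$-free $\mathcal{H}$ on $n\ge N_0$ vertices with $\delta_Q(\mathcal{H})\ge(1-\varepsilon)\frac{v(Q)\mathrm{inj}(n,Q,\mathcal{F})}{n}$ lies in $\mathfrak{H}$; $Q$-vertex-extendable if there are $\varepsilon>0,N_0$ such that every $\mathcal{F}$-free $\mathcal{H}$ on $n\ge N_0$ vertices with $\delta_Q(\mathcal{H})\ge(1-\varepsilon)\frac{v(Q)\mathrm{inj}(n,Q,\mathcal{F})}{n}$ and $\mathcal{H}-v\in\mathfrak{H}$ for some $v$ lies in $\mathfrak{H}$. *)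

theory Defs
  imports Complex_Main "HOL-Library.FuncSet"
begin

(* Vertices are drawn from nat. All vertex sets are finite, so every r-graph has an isomorphic copy
   here. Families of r-graphs are sets of such labelled graphs. *)
type_synonym hypergraph = "nat set \<times> nat set set"

abbreviation verts :: "hypergraph \<Rightarrow> nat set" where
  "verts H \<equiv> fst H"

abbreviation edges :: "hypergraph \<Rightarrow> nat set set" where
  "edges H \<equiv> snd H"

definition rgraph :: "nat \<Rightarrow> hypergraph \<Rightarrow> bool" where
  "rgraph r H \<longleftrightarrow> finite (verts H) \<and> (\<forall>e\<in>edges H. e \<subseteq> verts H \<and> card e = r)"

(* The last conjunct makes G itself a hypergraph. *)
definition subgraph :: "hypergraph \<Rightarrow> hypergraph \<Rightarrow> bool" where
  "subgraph G H \<longleftrightarrow>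
     verts G \<subseteq> verts H \<and> edges G \<subseteq> edges H \<and> (\<forall>e\<in>edges G. e \<subseteq> verts G)"

definition isomorphic :: "hypergraph \<Rightarrow> hypergraph \<Rightarrow> bool" where
  "isomorphic G H \<longleftrightarrow>
     (\<exists>f. bij_betw f (verts G) (verts H) \<and> edges H = (\<lambda>e. f ` e) ` edges G)"

definition delete_vertex :: "hypergraph \<Rightarrow> nat \<Rightarrow> hypergraph" where
  "delete_vertex H v = (verts H - {v}, {e \<in> edges H. v \<notin> e})"

(* A member of the family is contained up to isomorphism. *)
definition free :: "hypergraph set \<Rightarrow> hypergraph \<Rightarrow> bool" where
  "free \<F> H \<longleftrightarrow> \<not> (\<exists>F\<in>\<F>. \<exists>G. subgraph G H \<and> isomorphic F G)"

(* Extensional functions, so that each map on verts Q is counted once. *)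
definition homs :: "hypergraph \<Rightarrow> hypergraph \<Rightarrow> (nat \<Rightarrow> nat) set" where
  "homs Q H = {\<phi> \<in> verts Q \<rightarrow>\<^sub>E verts H. \<forall>e\<in>edges Q. \<phi> ` e \<in> edges H}"

definition inj_homs :: "hypergraph \<Rightarrow> hypergraph \<Rightarrow> (nat \<Rightarrow> nat) set" where
  "inj_homs Q H = {\<phi> \<in> homs Q H. inj_on \<phi> (verts Q)}"

definition inj_count :: "hypergraph \<Rightarrow> hypergraph \<Rightarrow> nat" where
  "inj_count Q H = card (inj_homs Q H)"

definition degree :: "hypergraph \<Rightarrow> hypergraph \<Rightarrow> nat \<Rightarrow> nat" where
  "degree Q H v = card {\<phi> \<in> inj_homs Q H. v \<in> \<phi> ` verts Q}"

definition min_degree :: "hypergraph \<Rightarrow> hypergraph \<Rightarrow> nat" where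
  "min_degree Q H = Min (degree Q H ` verts H)"

(* The set is bounded by n ^ card (verts Q), so its supremum in nat is its maximum; the supremum
   is 0 if there is no free r-graph on n vertices. *)
definition inj_max :: "nat \<Rightarrow> nat \<Rightarrow> hypergraph \<Rightarrow> hypergraph set \<Rightarrow> nat" where
  "inj_max r n Q \<F> =
     Sup {inj_count Q H | H. rgraph r H \<and> card (verts H) = n \<and> free \<F> H}"

definition pi_inj :: "nat \<Rightarrow> hypergraph \<Rightarrow> hypergraph set \<Rightarrow> real" where
  "pi_inj r Q \<F> = lim (\<lambda>n. real (inj_max r n Q \<F>) / real n ^ card (verts Q))"

definition hereditary :: "hypergraph set \<Rightarrow> bool" where
  "hereditary \<HH> \<longleftrightarrow> (\<forall>H\<in>\<HH>. \<forall>G. subgraph G H \<longrightarrow> G \<in> \<HH>)"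

definition edge_stable ::
  "nat \<Rightarrow> hypergraph \<Rightarrow> hypergraph set \<Rightarrow> hypergraph set \<Rightarrow> bool" where
  "edge_stable r Q \<F> \<HH> \<longleftrightarrow>
     (\<forall>\<epsilon>::real. \<epsilon> > 0 \<longrightarrow> (\<exists>\<delta>::real. \<delta> > 0 \<and> (\<exists>N\<^sub>0::nat. \<forall>n\<ge>N\<^sub>0. \<forall>H.
        rgraph r H \<and> card (verts H) = n \<and> free \<F> H \<and>
        real (inj_count Q H) \<ge> (1 - \<delta>) * real (inj_max r n Q \<F>) \<longrightarrow>
        (\<exists>A \<subseteq> edges H. real (card A) \<le> \<epsilon> * real n ^ r \<and> (verts H, edges H - A) \<in> \<HH>))))"

definition degree_stable ::
  "nat \<Rightarrow> hypergraph \<Rightarrow> hypergraph set \<Rightarrow> hypergraph set \<Rightarrow> bool" where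
  "degree_stable r Q \<F> \<HH> \<longleftrightarrow>
     (\<exists>\<epsilon>::real. \<epsilon> > 0 \<and> (\<exists>N\<^sub>0::nat. \<forall>n\<ge>N\<^sub>0. \<forall>H.
        rgraph r H \<and> card (verts H) = n \<and> free \<F> H \<and>
        real (min_degree Q H) \<ge>
          (1 - \<epsilon>) * (real (card (verts Q)) * real (inj_max r n Q \<F>) / real n) \<longrightarrow>
        H \<in> \<HH>))"

definition vertex_extendable ::
  "nat \<Rightarrow> hypergraph \<Rightarrow> hypergraph set \<Rightarrow> hypergraph set \<Rightarrow> bool" where
  "vertex_extendable r Q \<F> \<HH> \<longleftrightarrow>
     (\<exists>\<epsilon>::real. \<epsilon> > 0 \<and> (\<exists>N\<^sub>0::nat. \<forall>n\<ge>N\<^sub>0. \<forall>H.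
        rgraph r H \<and> card (verts H) = n \<and> free \<F> H \<and>
        real (min_degree Q H) \<ge>
          (1 - \<epsilon>) * (real (card (verts Q)) * real (inj_max r n Q \<F>) / real n) \<and>
        (\<exists>v\<in>verts H. delete_vertex H v \<in> \<HH>) \<longrightarrow>
        H \<in> \<HH>))"

end

theory Submission
  imports Defs
begin

text \<open>A host \<open>H\<close> of large minimum \<open>Q\<close>-degree has nearly the maximum number of copies of \<open>Q\<close>, so
  edge-stability provides a small edge set \<open>A\<close> with \<open>H - A\<close> in the family. Delete also the few
  vertices \<open>B\<close> incident with many edges of \<open>A\<close>, then run through the vertices of \<open>H\<close>, at each
  step putting the current vertex \<open>x\<close> and all edges at \<open>x\<close> back. Deleting \<open>x\<close> again gives a subgraph
  of the previous stage, so vertex-extendability keeps every stage in the family provided its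
  minimum degree is large. It is, since a vertex present at some stage either has few
  edges of \<open>A\<close> or has recovered all of its edges. The last stage is \<open>H\<close>.\<close>

section \<open>Subgraphs and what they inherit\<close>

lemma subgraph_trans: "subgraph G H \<Longrightarrow> subgraph H K \<Longrightarrow> subgraph G K"
  unfolding subgraph_def by blast

lemma free_subgraph: "free \<F> H \<Longrightarrow> subgraph G H \<Longrightarrow> free \<F> G"
  unfolding free_def using subgraph_trans by blast

lemma rgraph_subgraph: "rgraph r H \<Longrightarrow> subgraph G H \<Longrightarrow> rgraph r G"
  unfolding rgraph_def subgraph_def by (auto intro: finite_subset)

lemma finite_edges: "rgraph r H \<Longrightarrow> finite (edges H)"
  unfolding rgraph_def by (rule finite_subset[of _ "Pow (verts H)"]) auto

lemma subgraph_delete_vertex: "rgraph r H \<Longrightarrow> subgraph (delete_vertex H v) H"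
  unfolding subgraph_def delete_vertex_def rgraph_def by auto

section \<open>Counting injective homomorphisms\<close>

lemma finite_inj_homs:
  assumes "rgraph r Q" "rgraph r H"
  shows "finite (inj_homs Q H)"
proof (rule finite_subset)
  show "inj_homs Q H \<subseteq> verts Q \<rightarrow>\<^sub>E verts H"
    by (auto simp: inj_homs_def homs_def)
  show "finite (verts Q \<rightarrow>\<^sub>E verts H)"
    using assms by (auto simp: rgraph_def intro: finite_PiE)
qed

lemma inj_count_le_power:
  assumes "rgraph r Q" "rgraph r H"
  shows "inj_count Q H \<le> card (verts H) ^ card (verts Q)"
proof -
  have "inj_count Q H \<le> card (verts Q \<rightarrow>\<^sub>E verts H)"
    unfolding inj_count_def using assms
    by (intro card_mono finite_PiE) (auto simp: rgraph_def inj_homs_def homs_def)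
  then show ?thesis using assms by (simp add: card_PiE rgraph_def)
qed

text \<open>Double counting of pairs of a copy and a vertex in its image: injectivity gives every
  copy exactly \<open>card (verts Q)\<close> image vertices.\<close>

lemma sum_degree:
  assumes Q: "rgraph r Q" and H: "rgraph r H"
  shows "(\<Sum>v\<in>verts H. degree Q H v) = card (verts Q) * inj_count Q H"
proof -
  have fin: "finite (inj_homs Q H)" by (rule finite_inj_homs[OF assms])
  have fV: "finite (verts H)" using H by (simp add: rgraph_def)
  have "(\<Sum>v\<in>verts H. degree Q H v)
      = (\<Sum>v\<in>verts H. \<Sum>\<phi>\<in>inj_homs Q H. if v \<in> \<phi> ` verts Q then 1 else 0)"
    unfolding degree_def using fin by (intro sum.cong) (simp_all add: sum.If_cases Int_def)
  also have "\<dots> = (\<Sum>\<phi>\<in>inj_homs Q H. \<Sum>v\<in>verts H. if v \<in> \<phi> ` verts Q then 1 else 0)"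
    by (rule sum.swap)
  also have "\<dots> = (\<Sum>\<phi>\<in>inj_homs Q H. card (verts Q))"
  proof (rule sum.cong)
    fix \<phi> assume phi: "\<phi> \<in> inj_homs Q H"
    then have "verts H \<inter> \<phi> ` verts Q = \<phi> ` verts Q" by (auto simp: inj_homs_def homs_def)
    moreover have "card (\<phi> ` verts Q) = card (verts Q)"
      using phi by (auto simp: inj_homs_def card_image)
    ultimately show "(\<Sum>v\<in>verts H. if v \<in> \<phi> ` verts Q then 1 else 0) = card (verts Q)"
      using fV by (simp add: sum.If_cases)
  qed simp
  finally show ?thesis by (simp add: inj_count_def)
qed

text \<open>Edges of \<open>Q\<close> lie inside \<open>verts Q\<close>, so a map whose image avoids
  \<open>v\<close> sends them only to edges avoiding \<open>v\<close>, and these all survive the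
  deletion.\<close>

lemma inj_homs_delete_vertex:
  assumes "rgraph r Q"
  shows "inj_homs Q (delete_vertex H v) = {\<phi> \<in> inj_homs Q H. v \<notin> \<phi> ` verts Q}"
  using assms unfolding inj_homs_def homs_def delete_vertex_def rgraph_def
  by (auto simp: PiE_iff) blast

lemma inj_count_delete_vertex:
  assumes "rgraph r Q" "rgraph r H"
  shows "inj_count Q (delete_vertex H v) + degree Q H v = inj_count Q H"
proof -
  let ?A = "{\<phi> \<in> inj_homs Q H. v \<notin> \<phi> ` verts Q}" and ?B = "{\<phi> \<in> inj_homs Q H. v \<in> \<phi> ` verts Q}"
  have "card (?A \<union> ?B) = card ?A + card ?B"
    using finite_inj_homs[OF assms] by (intro card_Un_disjoint) auto
  moreover have "?A \<union> ?B = inj_homs Q H" by auto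
  ultimately show ?thesis
    by (simp only: inj_count_def degree_def inj_homs_delete_vertex[OF assms(1)])
qed

section \<open>The extremal number \<open>inj_max\<close> and its growth\<close>

lemma bdd_inj_counts:
  assumes "rgraph r Q"
  shows "bdd_above {inj_count Q H | H. rgraph r H \<and> card (verts H) = n \<and> free \<F> H}"
  using inj_count_le_power[OF assms] by (intro bdd_aboveI[of _ "n ^ card (verts Q)"]) auto

lemma inj_count_le_inj_max:
  assumes "rgraph r Q" "rgraph r H" "free \<F> H"
  shows "inj_count Q H \<le> inj_max r (card (verts H)) Q \<F>"
  unfolding inj_max_def using assms by (intro cSup_upper bdd_inj_counts CollectI exI[of _ H]) auto

text \<open>The first disjunct absorbs the case without any free r-graph on \<open>n\<close>
  vertices, where the supremum of the empty set is 0.\<close>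

lemma inj_max_attained:
  assumes "rgraph r Q"
  shows "inj_max r n Q \<F> = 0 \<or>
    (\<exists>H. rgraph r H \<and> card (verts H) = n \<and> free \<F> H \<and> inj_count Q H = inj_max r n Q \<F>)"
proof -
  let ?S = "{inj_count Q H | H. rgraph r H \<and> card (verts H) = n \<and> free \<F> H}"
  show ?thesis
  proof (cases "?S = {}")
    case True
    then show ?thesis unfolding inj_max_def True by (simp add: Sup_nat_def)
  next
    case False
    \<comment> \<open>A bounded set of naturals is finite, and \<open>Sup\<close> of a nonempty one
      is defined as its \<open>Max\<close>, hence a member.\<close>
    have "Sup ?S \<in> ?S"
      using Max_in[OF bdd_inj_counts[OF assms, THEN bdd_above_nat[THEN iffD1]] False] False
      by (simp only: Sup_nat_def if_False)
    then show ?thesis unfolding inj_max_def by (auto simp only: mem_Collect_eq)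
  qed
qed

text \<open>Delete each vertex of an extremal graph in turn. A copy survives all deletions except
  those of its own \<open>card (verts Q)\<close> vertices, while each deleted graph is free on
  \<open>n\<close> vertices and has at most \<open>inj_max r n Q \<F>\<close> copies.\<close>

lemma inj_max_Suc:
  assumes Q: "rgraph r Q" and "card (verts Q) \<le> Suc n"
  shows "(Suc n - card (verts Q)) * inj_max r (Suc n) Q \<F> \<le> Suc n * inj_max r n Q \<F>"
proof (cases "inj_max r (Suc n) Q \<F> = 0")
  case False
  then obtain H where H: "rgraph r H" "card (verts H) = Suc n" "free \<F> H"
    and eq: "inj_count Q H = inj_max r (Suc n) Q \<F>"
    using inj_max_attained[OF Q] by metis
  have fV: "finite (verts H)" using H by (simp add: rgraph_def)
  have "Suc n * inj_count Q H
      = (\<Sum>v\<in>verts H. inj_count Q (delete_vertex H v) + degree Q H v)"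
    by (simp add: inj_count_delete_vertex[OF Q H(1)] H(2))
  also have "\<dots> = (\<Sum>v\<in>verts H. inj_count Q (delete_vertex H v)) + card (verts Q) * inj_count Q H"
    by (simp only: sum.distrib sum_degree[OF Q H(1)])
  also have "(\<Sum>v\<in>verts H. inj_count Q (delete_vertex H v)) \<le> (\<Sum>v\<in>verts H. inj_max r n Q \<F>)"
  proof (rule sum_mono)
    fix v assume v: "v \<in> verts H"
    have sub: "subgraph (delete_vertex H v) H" by (rule subgraph_delete_vertex[OF H(1)])
    have "card (verts (delete_vertex H v)) = n"
      using v fV H(2) by (simp add: delete_vertex_def)
    then show "inj_count Q (delete_vertex H v) \<le> inj_max r n Q \<F>"
      using inj_count_le_inj_max[OF Q rgraph_subgraph[OF H(1) sub] free_subgraph[OF H(3) sub]]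
      by simp
  qed
  also have "\<dots> = Suc n * inj_max r n Q \<F>" by (simp add: H(2))
  finally show ?thesis unfolding eq by (simp add: diff_mult_distrib)
qed simp

text \<open>For positive \<open>n\<close> the quotient is a product of \<open>q\<close> factors
  \<open>1 - i / n\<close> over \<open>fact q\<close>, and each of these finitely many factors tends
  to 1.\<close>

lemma tendsto_binomial_div_power:
  "(\<lambda>n. real (n choose q) / real n ^ q) \<longlonglongrightarrow> 1 / fact q"
proof -
  have "(\<lambda>n. (\<Prod>i<q. 1 - real i / real n) / fact q) \<longlonglongrightarrow> (\<Prod>i<q. 1 - 0) / fact q"
    by (intro tendsto_divide tendsto_prod tendsto_diff tendsto_const lim_const_over_n) simp
  moreover have "\<forall>\<^sub>F n in sequentially.
      (\<Prod>i<q. 1 - real i / real n) / fact q = real (n choose q) / real n ^ q"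
    using eventually_gt_at_top[of 0]
  proof eventually_elim
    case (elim n)
    have "(\<Prod>i<q. 1 - real i / real n) = (\<Prod>i<q. (real n - real i) / real n)"
      using elim by (intro prod.cong) (auto simp: field_simps)
    also have "\<dots> = (\<Prod>i<q. real n - real i) / real n ^ q"
      by (simp add: prod_dividef)
    finally show ?case
      by (simp add: binomial_gbinomial gbinomial_prod_rev lessThan_atLeast0)
  qed
  ultimately show ?thesis
    by (auto dest: Lim_transform_eventually)
qed

text \<open>Averaging over vertex deletions shows that \<open>inj_max\<close> divided by a binomial coefficient is
  nonincreasing, hence the limit in the definition of \<open>pi_inj\<close> exists.\<close>
lemma inj_max_tendsto:
  assumes Q: "rgraph r Q"
  shows "(\<lambda>n. real (inj_max r n Q \<F>) / real n ^ card (verts Q)) \<longlonglongrightarrow> pi_inj r Q \<F>"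
proof -
  define q where "q = card (verts Q)"
  \<comment> \<open>The shift by \<open>q\<close> keeps every binomial coefficient positive;
    \<open>LIMSEQ_offset\<close> undoes it later.\<close>
  define b where "b n = real (inj_max r (n + q) Q \<F>) / real ((n + q) choose q)" for n
  have "decseq b"
  proof (rule decseq_SucI)
    fix n
    let ?N = "n + q"
    have 1: "real (Suc n) * real (inj_max r (Suc ?N) Q \<F>) \<le> real (Suc ?N) * real (inj_max r ?N Q \<F>)"
    proof -
      have "Suc n * inj_max r (Suc ?N) Q \<F> \<le> Suc ?N * inj_max r ?N Q \<F>"
        using inj_max_Suc[OF Q, of "?N" \<F>] by (simp add: q_def)
      then show ?thesis by (metis of_nat_le_iff of_nat_mult)
    qed
    have "Suc ?N * (?N choose q) = (Suc ?N choose q) * Suc n"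
    proof -
      have "(Suc ?N - q) * (Suc ?N choose q) = Suc ?N * (?N choose q)"
        using binomial_absorb_comp[of "Suc ?N" q] by simp
      then show ?thesis by (simp add: mult.commute)
    qed
    then have 2: "real (Suc ?N) * real (?N choose q) = real (Suc ?N choose q) * real (Suc n)"
      by (metis of_nat_mult)
    have p: "real (?N choose q) > 0" "real (Suc ?N choose q) > 0" by simp_all
    have "real (Suc n) * (real (inj_max r (Suc ?N) Q \<F>) * real (?N choose q))
        \<le> real (Suc ?N) * real (inj_max r ?N Q \<F>) * real (?N choose q)"
      using mult_right_mono[OF 1, of "real (?N choose q)"] p by (simp only: mult.assoc)
    also have "\<dots> = real (Suc n) * (real (inj_max r ?N Q \<F>) * real (Suc ?N choose q))"
      using 2 by (metis mult.commute mult.left_commute)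
    finally have "real (inj_max r (Suc ?N) Q \<F>) * real (?N choose q)
        \<le> real (inj_max r ?N Q \<F>) * real (Suc ?N choose q)"
      by (rule mult_left_le_imp_le) simp
    then show "b (Suc n) \<le> b n"
      unfolding b_def using p by (simp add: divide_simps mult.commute)
  qed
  moreover have "\<And>n. 0 \<le> b n" by (simp add: b_def)
  ultimately obtain L where "b \<longlonglongrightarrow> L"
    using decseq_convergent[of b 0] by metis
  then have L: "(\<lambda>n. real (inj_max r n Q \<F>) / real (n choose q)) \<longlonglongrightarrow> L"
    unfolding b_def by (rule LIMSEQ_offset)
  \<comment> \<open>Multiplying by the convergent binomial ratio trades the normalisation by
    \<open>n choose q\<close> for the one by \<open>n ^ q\<close> used in
    \<open>pi_inj\<close>.\<close>
  have "(\<lambda>n. real (inj_max r n Q \<F>) / real (n choose q) * (real (n choose q) / real n ^ q))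
      \<longlonglongrightarrow> L * (1 / fact q)"
    by (intro tendsto_mult L tendsto_binomial_div_power)
  moreover have "\<forall>\<^sub>F n in sequentially.
      real (inj_max r n Q \<F>) / real (n choose q) * (real (n choose q) / real n ^ q)
      = real (inj_max r n Q \<F>) / real n ^ q"
    using eventually_ge_at_top[of q] by eventually_elim (simp add: divide_simps)
  ultimately have "(\<lambda>n. real (inj_max r n Q \<F>) / real n ^ q) \<longlonglongrightarrow> L * (1 / fact q)"
    by (rule Lim_transform_eventually)
  then have "convergent (\<lambda>n. real (inj_max r n Q \<F>) / real n ^ q)"
    by (auto simp: convergent_def)
  then show ?thesis
    unfolding pi_inj_def q_def by (simp add: convergent_LIMSEQ_iff)
qed

lemma inj_max_bounds:
  assumes "rgraph r Q" "pi_inj r Q \<F> > 0" "\<rho> > 0"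
  shows "\<exists>N. \<forall>n\<ge>N.
    (1 - \<rho>) * pi_inj r Q \<F> * real n ^ card (verts Q) \<le> real (inj_max r n Q \<F>) \<and>
    real (inj_max r n Q \<F>) \<le> (1 + \<rho>) * pi_inj r Q \<F> * real n ^ card (verts Q)"
proof -
  let ?p = "pi_inj r Q \<F>" and ?q = "card (verts Q)"
  have "\<rho> * ?p > 0" using assms by simp
  from LIMSEQ_D[OF inj_max_tendsto[OF assms(1)] this]
  obtain N where N: "\<And>n. n \<ge> N \<Longrightarrow> norm (real (inj_max r n Q \<F>) / real n ^ ?q - ?p) < \<rho> * ?p"
    by blast
  show ?thesis
  proof (intro exI allI impI)
    fix n assume n: "n \<ge> max N 1"
    then have pos: "real n ^ ?q > 0" by simp
    have "?p - \<rho> * ?p \<le> real (inj_max r n Q \<F>) / real n ^ ?q"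
      "real (inj_max r n Q \<F>) / real n ^ ?q \<le> ?p + \<rho> * ?p"
      using N[of n] n by (auto simp: abs_less_iff)
    then show "(1 - \<rho>) * ?p * real n ^ ?q \<le> real (inj_max r n Q \<F>) \<and>
      real (inj_max r n Q \<F>) \<le> (1 + \<rho>) * ?p * real n ^ ?q"
      using pos by (simp add: le_divide_eq divide_le_eq algebra_simps)
  qed
qed

section \<open>Degree loss when passing to a subgraph\<close>

lemma card_PiE_prescribed:
  fixes V :: "'a \<Rightarrow> 'b set"
  assumes "finite I" "T \<subseteq> I" "card W > 0"
  shows "real (card (PiE I (\<lambda>y. if y \<in> T then P y else W)))
    = (\<Prod>y\<in>T. real (card (P y))) * real (card W) ^ card I / real (card W) ^ card T"
proof -
  have fT: "finite T" using assms finite_subset by blast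
  have "card (PiE I (\<lambda>y. if y \<in> T then P y else W))
      = (\<Prod>y\<in>I. card (if y \<in> T then P y else W))"
    using assms by (simp add: card_PiE)
  also have "\<dots> = (\<Prod>y\<in>I - T. card W) * (\<Prod>y\<in>T. card (P y))"
    using assms by (subst prod.subset_diff[of T I]) auto
  also have "\<dots> = (\<Prod>y\<in>T. card (P y)) * card W ^ (card I - card T)"
    using fT assms by (simp add: card_Diff_subset)
  finally have "real (card (PiE I (\<lambda>y. if y \<in> T then P y else W)))
      = (\<Prod>y\<in>T. real (card (P y))) * real (card W) ^ (card I - card T)"
    by simp
  \<comment> \<open>This makes the subtraction of exponents exact, so the count can be a quotient:
    every prescribed coordinate costs one factor \<open>card W\<close>.\<close>
  moreover have "card T \<le> card I" using assms by (simp add: card_mono)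
  ultimately show ?thesis using assms(3) by (simp add: power_diff)
qed

text \<open>Applied once per index, this bounds nested unions. Keeping \<open>k\<close> apart from
  \<open>card I\<close> lets index sets such as \<open>verts Q - e\<close> be bounded uniformly by
  \<open>card (verts Q)\<close>.\<close>

lemma card_UN_bound:
  fixes c :: real
  assumes "finite I" "card I \<le> k" "c \<ge> 0" "\<And>i. i \<in> I \<Longrightarrow> real (card (X i)) \<le> c"
  shows "real (card (\<Union>i\<in>I. X i)) \<le> real k * c"
proof -
  have "real (card (\<Union>i\<in>I. X i)) \<le> real (\<Sum>i\<in>I. card (X i))"
    using card_UN_le[OF assms(1), of X] by (simp only: of_nat_le_iff)
  also have "\<dots> \<le> (\<Sum>i\<in>I. c)" using sum_mono[of I "\<lambda>i. real (card (X i))" "\<lambda>_. c"] assms(4) by simp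
  also have "\<dots> \<le> real k * c" using assms by (simp add: mult_right_mono)
  finally show ?thesis .
qed

text \<open>A lost copy of \<open>Q\<close> through \<open>w\<close> meets a lost vertex, or uses a lost edge at \<open>w\<close>,
  or uses a lost edge avoiding \<open>w\<close>; the latter, together with \<open>w\<close>, occupies \<open>r + 1\<close> vertices
  of the copy, which is why deleting \<open>o(n^r)\<close> edges is harmless there.\<close>
lemma degree_subgraph_loss:
  assumes Q: "rgraph r Q" and H: "rgraph r H" and GH: "subgraph G H" and w: "w \<in> verts G"
  defines "n \<equiv> real (card (verts H))" and "q \<equiv> card (verts Q)"
    and "D \<equiv> {a \<in> edges H - edges G. a \<subseteq> verts G}"
  shows "real (degree Q H w) \<le> real (degree Q G w)
     + real (card (verts H - verts G)) * (real q * (real q * (n ^ q / n ^ 2)))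
     + real (card (edges Q)) * (real (card {a \<in> D. w \<in> a}) * (real r ^ r * n ^ q / n ^ r))
     + real (card (edges Q)) * (real (card D) * (real q * (real r ^ r * n ^ q / n ^ Suc r)))"
proof -
  let ?VQ = "verts Q" and ?V = "verts H"
  have fQ: "finite ?VQ" and fV: "finite ?V" and fEQ: "finite (edges Q)"
    and edge: "\<And>e. e \<in> edges Q \<Longrightarrow> e \<subseteq> ?VQ \<and> card e = r \<and> finite e"
    using Q finite_edges[OF Q] H by (auto simp: rgraph_def intro: finite_subset)
  have fD: "finite D" using finite_edges[OF H] by (simp add: D_def)
  have cD: "\<And>a. a \<in> D \<Longrightarrow> card a = r \<and> finite a"
    using H by (auto simp: D_def rgraph_def intro: finite_subset)
  have wV: "w \<in> ?V" using w GH by (auto simp: subgraph_def)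
  have cV: "card ?V > 0" using wV fV by (auto simp: card_gt_0_iff)
  have n0: "n > 0" using cV by (simp add: n_def)
  \<comment> \<open>Only the values on \<open>T\<close> are constrained. Dropping injectivity and
    the edge conditions enlarges the set of maps but gives it an exact product count.\<close>
  define P where "P T f = PiE ?VQ (\<lambda>y. if y \<in> T then f y else ?V)" for T and f :: "nat \<Rightarrow> nat set"
  define X where "X = (\<Union>u\<in>?V - verts G. \<Union>x\<in>?VQ. \<Union>y\<in>?VQ - {x}.
      P {x, y} (\<lambda>z. if z = x then {w} else {u}))"
  define Y where "Y = (\<Union>e\<in>edges Q. \<Union>a\<in>{a \<in> D. w \<in> a}. P e (\<lambda>_. a))"
  define Z where "Z = (\<Union>e\<in>edges Q. \<Union>a\<in>D. \<Union>x\<in>?VQ - e.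
      P (insert x e) (\<lambda>z. if z = x then {w} else a))"
  have fP: "finite (P T f)" if "\<And>y. y \<in> T \<Longrightarrow> finite (f y)" for T f
    unfolding P_def using that fQ fV by (intro finite_PiE) auto
  have fX: "finite X" unfolding X_def using fQ fV by (intro finite_UN_I fP) auto
  have fY: "finite Y" unfolding Y_def using fEQ fD cD by (intro finite_UN_I fP) auto
  have fZ: "finite Z" unfolding Z_def using fEQ fD fQ cD by (intro finite_UN_I fP) auto
  let ?dH = "{\<phi> \<in> inj_homs Q H. w \<in> \<phi> ` ?VQ}" and ?dG = "{\<phi> \<in> inj_homs Q G. w \<in> \<phi> ` ?VQ}"
  have "?dH \<subseteq> ?dG \<union> X \<union> Y \<union> Z"
  proof
    fix \<phi> assume phi: "\<phi> \<in> ?dH"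
    then obtain x where x: "x \<in> ?VQ" "\<phi> x = w" by auto
    have ext: "\<phi> \<in> ?VQ \<rightarrow>\<^sub>E ?V" and inj: "inj_on \<phi> ?VQ"
      and ed: "\<And>e. e \<in> edges Q \<Longrightarrow> \<phi> ` e \<in> edges H"
      using phi by (auto simp: inj_homs_def homs_def)
    show "\<phi> \<in> ?dG \<union> X \<union> Y \<union> Z"
    \<comment> \<open>Lost vertices are treated first (\<open>X\<close>), so that afterwards any
      lost edge of the copy lies inside \<open>verts G\<close> and therefore in
      \<open>D\<close>.\<close>
    proof (cases "\<phi> ` ?VQ \<subseteq> verts G")
      case False
      then obtain y where y: "y \<in> ?VQ" "\<phi> y \<notin> verts G" by auto
      have "y \<noteq> x" using y x w by auto
      moreover have "\<phi> y \<in> ?V - verts G" using y ext by (auto simp: PiE_iff)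
      moreover have "\<phi> \<in> P {x, y} (\<lambda>z. if z = x then {w} else {\<phi> y})"
        using ext x by (auto simp: P_def PiE_iff)
      ultimately show ?thesis using x y unfolding X_def by blast
    next
      case True
      show ?thesis
      proof (cases "\<forall>e\<in>edges Q. \<phi> ` e \<in> edges G")
        case all: True
        have "\<phi> \<in> inj_homs Q G"
          using ext inj all True by (auto simp: inj_homs_def homs_def PiE_iff)
        then show ?thesis using phi by blast
      next
        case False
        then obtain e where e: "e \<in> edges Q" "\<phi> ` e \<notin> edges G" by auto
        have aD: "\<phi> ` e \<in> D" using e ed edge[of e] True by (auto simp: D_def)
        show ?thesis
        proof (cases "w \<in> \<phi> ` e")
          case we: True
          have "\<phi> \<in> P e (\<lambda>_. \<phi> ` e)" using ext by (auto simp: P_def PiE_iff)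
          then show ?thesis using e aD we unfolding Y_def by blast
        next
          case we: False
          then have "x \<in> ?VQ - e" using x by auto
          moreover have "\<phi> \<in> P (insert x e) (\<lambda>z. if z = x then {w} else \<phi> ` e)"
            using ext x by (auto simp: P_def PiE_iff)
          ultimately show ?thesis using e aD unfolding Z_def by blast
        qed
      qed
    qed
  qed
  moreover have "finite ?dG"
    using finite_inj_homs[OF Q rgraph_subgraph[OF H GH]] by simp
  ultimately have "card ?dH \<le> card (?dG \<union> X \<union> Y \<union> Z)"
    using fX fY fZ by (intro card_mono) auto
  also have "\<dots> \<le> card ?dG + card X + card Y + card Z"
    using card_Un_le[of "?dG \<union> X \<union> Y" Z] card_Un_le[of "?dG \<union> X" Y] card_Un_le[of ?dG X] by linarith
  finally have main: "real (degree Q H w)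
      \<le> real (degree Q G w) + real (card X) + real (card Y) + real (card Z)"
    unfolding degree_def by linarith
  have "real (card X) \<le> real (card (?V - verts G)) * (real q * (real q * (n ^ q / n ^ 2)))"
    unfolding X_def
  proof (intro card_UN_bound)
    fix u x y assume *: "u \<in> ?V - verts G" "x \<in> ?VQ" "y \<in> ?VQ - {x}"
    then show "real (card (P {x, y} (\<lambda>z. if z = x then {w} else {u}))) \<le> n ^ q / n ^ 2"
      unfolding P_def using card_PiE_prescribed[OF fQ _ cV, of "{x, y}"]
      by (simp add: n_def q_def power2_eq_square)
  qed (use fQ fV n0 in \<open>auto simp: q_def intro: card_mono\<close>)
  moreover have "real (card Y)
      \<le> real (card (edges Q)) * (real (card {a \<in> D. w \<in> a}) * (real r ^ r * n ^ q / n ^ r))"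
    unfolding Y_def
  proof (intro card_UN_bound)
    fix e a assume *: "e \<in> edges Q" "a \<in> {a \<in> D. w \<in> a}"
    then show "real (card (P e (\<lambda>_. a))) \<le> real r ^ r * n ^ q / n ^ r"
      unfolding P_def using edge[of e] cD[of a] card_PiE_prescribed[OF fQ _ cV, of e]
      by (simp add: n_def q_def)
  qed (use fEQ fD n0 in auto)
  moreover have "real (card Z)
      \<le> real (card (edges Q)) * (real (card D) * (real q * (real r ^ r * n ^ q / n ^ Suc r)))"
    unfolding Z_def
  proof (intro card_UN_bound)
    fix e a x assume *: "e \<in> edges Q" "a \<in> D" "x \<in> ?VQ - e"
    have e: "e \<subseteq> ?VQ" "card e = r" "finite e" using edge *(1) by auto
    \<comment> \<open>Since \<open>x\<close> is outside \<open>e\<close>, the singleton never occurs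
      in this product; prescribing \<open>x\<close> contributes a factor 1 and one more power of
      \<open>n\<close> in the denominator.\<close>
    have pr: "(\<Prod>y\<in>e. real (card (if y = x then {w} else a))) = real r ^ r"
    proof -
      have "(\<Prod>y\<in>e. real (card (if y = x then {w} else a))) = (\<Prod>y\<in>e. real r)"
        using * cD[of a] by (intro prod.cong) auto
      then show ?thesis using e by simp
    qed
    then show "real (card (P (insert x e) (\<lambda>z. if z = x then {w} else a)))
        \<le> real r ^ r * n ^ q / n ^ Suc r"
      unfolding P_def using e * cD[of a]
      by (subst card_PiE_prescribed[OF fQ _ cV]) (auto simp: n_def q_def)
  qed (use fEQ fD fQ n0 in \<open>auto simp: q_def intro: card_mono\<close>)
  ultimately show ?thesis using main by linarith
qed

section \<open>Stages of the restoration\<close>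

text \<open>The stage of the restoration at which exactly the vertices of \<open>S\<close> have been processed.\<close>
definition restored :: "hypergraph \<Rightarrow> nat set set \<Rightarrow> nat set \<Rightarrow> nat set \<Rightarrow> hypergraph" where
  "restored H A B S = (verts H - (B - S),
     {e \<in> edges H. e \<subseteq> verts H - (B - S) \<and> (e \<notin> A \<or> e \<inter> S \<noteq> {})})"

lemma subgraph_restored: "subgraph (restored H A B S) H"
  unfolding subgraph_def restored_def by auto

lemma restored_empty: "subgraph (restored H A B {}) (verts H, edges H - A)"
  unfolding subgraph_def restored_def by auto

text \<open>Positive uniformity makes every edge nonempty, so each edge of \<open>A\<close> meets
  the processed set once that set is all of \<open>verts H\<close>.\<close>

lemma restored_verts:
  assumes "rgraph r H" "r > 0"
  shows "restored H A B (verts H) = H"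
proof -
  have "e \<subseteq> verts H \<and> e \<inter> verts H \<noteq> {}" if "e \<in> edges H" for e
  proof -
    have "e \<subseteq> verts H" "card e > 0" using assms that by (auto simp: rgraph_def)
    moreover from this have "e \<noteq> {}" by auto
    ultimately show ?thesis by blast
  qed
  then have "{e \<in> edges H. e \<subseteq> verts H \<and> (e \<notin> A \<or> e \<inter> verts H \<noteq> {})} = edges H" by blast
  moreover have "verts H - (B - verts H) = verts H" by blast
  ultimately show ?thesis by (simp add: restored_def)
qed

text \<open>An edge avoiding \<open>x\<close> meets \<open>insert x S\<close> exactly when it meets
  \<open>S\<close>, so whatever processing \<open>x\<close> brought back disappears again with
  \<open>x\<close>.\<close>

lemma delete_vertex_restored_insert:
  "subgraph (delete_vertex (restored H A B (insert x S)) x) (restored H A B S)"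
  unfolding subgraph_def restored_def delete_vertex_def by auto

text \<open>Markov's inequality: each edge of \<open>A\<close> has \<open>r\<close> vertices, so the
  degrees in \<open>A\<close> sum to \<open>r * card A\<close>, and each vertex counted on the left
  contributes more than \<open>d\<close>.\<close>

lemma few_vertices_of_large_degree:
  assumes V: "finite V" and A: "\<And>a. a \<in> A \<Longrightarrow> a \<subseteq> V \<and> card a = r" and "d > 0"
  shows "real (card {v \<in> V. d < real (card {a \<in> A. v \<in> a})}) * d \<le> real r * real (card A)"
proof -
  let ?B = "{v \<in> V. d < real (card {a \<in> A. v \<in> a})}"
  have fA: "finite A" using V A by (intro finite_subset[of A "Pow V"]) auto
  have "real (card ?B) * d = (\<Sum>v\<in>?B. d)" by simp
  also have "\<dots> \<le> (\<Sum>v\<in>?B. real (card {a \<in> A. v \<in> a}))" by (rule sum_mono) auto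
  also have "\<dots> \<le> (\<Sum>v\<in>V. real (card {a \<in> A. v \<in> a}))" using V by (intro sum_mono2) auto
  also have "\<dots> = real (\<Sum>v\<in>V. \<Sum>a\<in>A. if v \<in> a then 1 else 0)"
    using fA by (simp add: sum.If_cases Int_def)
  also have "(\<Sum>v\<in>V. \<Sum>a\<in>A. if v \<in> a then 1 else 0) = (\<Sum>a\<in>A. \<Sum>v\<in>V. if v \<in> a then 1 else 0)"
    by (rule sum.swap)
  also have "\<dots> = (\<Sum>a\<in>A. r)"
    using V A by (intro sum.cong) (auto simp: sum.If_cases Int_absorb1)
  finally show ?thesis by (simp add: mult.commute)
qed

text \<open>Specialises \<open>degree_subgraph_loss\<close> to a stage. All three losses become
  constants times \<open>n ^ q / n\<close>, the order of the degree threshold, with constants that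
  do not depend on \<open>S\<close>.\<close>

lemma degree_restored_ge:
  fixes \<beta> \<eta> :: real
  assumes Q: "rgraph r Q" and H: "rgraph r H" and A: "A \<subseteq> edges H"
    and w: "w \<in> verts (restored H A B S)"
  defines "n \<equiv> real (card (verts H))" and "q \<equiv> card (verts Q)"
    and "c \<equiv> real (card (edges Q)) * real r ^ r"
  assumes cA: "real (card A) \<le> \<beta> * n ^ r"
    and B: "\<And>v. v \<in> verts H \<Longrightarrow> v \<notin> B \<Longrightarrow> real (card {a \<in> A. v \<in> a}) \<le> \<eta> * n ^ r / n"
    and cB: "real (card (B \<inter> verts H)) \<le> \<kappa> * n" and "\<eta> \<ge> 0"
  shows "real (degree Q H w) \<le> real (degree Q (restored H A B S) w)
    + (real q ^ 2 * \<kappa> + c * \<eta> + c * real q * \<beta>) * (n ^ q / n)"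
proof -
  let ?G = "restored H A B S"
  define D where "D = {a \<in> edges H - edges ?G. a \<subseteq> verts ?G}"
  have fV: "finite (verts H)" using H by (simp add: rgraph_def)
  have fA: "finite A" using A finite_edges[OF H] finite_subset by blast
  have wV: "w \<in> verts H" using w by (simp add: restored_def)
  then have n: "n > 0" using fV by (auto simp: n_def card_gt_0_iff)
  have DA: "D \<subseteq> {a \<in> A. a \<inter> S = {}}" by (auto simp: D_def restored_def)
  have 1: "real (card D) \<le> \<beta> * n ^ r"
    using card_mono[of A D] DA fA cA by fastforce
  \<comment> \<open>A processed \<open>w\<close> lies on no edge of \<open>D\<close>; an unprocessed
    \<open>w\<close> present at this stage lies outside \<open>B\<close> and so on few edges of
    \<open>A\<close>.\<close>
  have 2: "real (card {a \<in> D. w \<in> a}) \<le> \<eta> * n ^ r / n"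
  proof (cases "w \<in> S")
    case True
    then have "{a \<in> D. w \<in> a} = {}" using DA by auto
    then have "card {a \<in> D. w \<in> a} = 0" by (simp only: card.empty)
    then show ?thesis using n \<open>\<eta> \<ge> 0\<close> by simp
  next
    case False
    then have "w \<notin> B" using w by (auto simp: restored_def)
    moreover have "card {a \<in> D. w \<in> a} \<le> card {a \<in> A. w \<in> a}"
      using DA fA by (intro card_mono) auto
    ultimately show ?thesis using B[OF wV] by linarith
  qed
  have "card (verts H - verts ?G) \<le> card (B \<inter> verts H)"
    using fV by (intro card_mono) (auto simp: restored_def)
  then have 3: "real (card (verts H - verts ?G)) \<le> \<kappa> * n" using cB by linarith
  have "real (card (verts H - verts ?G)) * (real q * (real q * (n ^ q / n ^ 2)))
      \<le> \<kappa> * n * (real q * (real q * (n ^ q / n ^ 2)))"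
    using 3 n by (intro mult_right_mono) auto
  also have "\<dots> = real q ^ 2 * \<kappa> * (n ^ q / n)"
    using n by (simp add: field_simps power2_eq_square)
  finally have x: "real (card (verts H - verts ?G)) * (real q * (real q * (n ^ q / n ^ 2)))
      \<le> real q ^ 2 * \<kappa> * (n ^ q / n)" .
  have "real (card (edges Q)) * (real (card {a \<in> D. w \<in> a}) * (real r ^ r * n ^ q / n ^ r))
      \<le> real (card (edges Q)) * (\<eta> * n ^ r / n * (real r ^ r * n ^ q / n ^ r))"
    using 2 n by (intro mult_left_mono mult_right_mono) auto
  also have "\<dots> = c * \<eta> * (n ^ q / n)"
    using n by (simp add: field_simps c_def)
  finally have y: "real (card (edges Q)) * (real (card {a \<in> D. w \<in> a}) * (real r ^ r * n ^ q / n ^ r))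
      \<le> c * \<eta> * (n ^ q / n)" .
  have "real (card (edges Q)) * (real (card D) * (real q * (real r ^ r * n ^ q / n ^ Suc r)))
      \<le> real (card (edges Q)) * (\<beta> * n ^ r * (real q * (real r ^ r * n ^ q / n ^ Suc r)))"
    using 1 n by (intro mult_left_mono mult_right_mono) auto
  also have "\<dots> = c * real q * \<beta> * (n ^ q / n)"
    using n by (simp add: field_simps c_def)
  finally have z: "real (card (edges Q)) * (real (card D) * (real q * (real r ^ r * n ^ q / n ^ Suc r)))
      \<le> c * real q * \<beta> * (n ^ q / n)" .
  show ?thesis
    using degree_subgraph_loss[OF Q H subgraph_restored w, folded n_def q_def D_def] x y z
    by (simp only: distrib_right)
qed

text \<open>Isolates the induction over processed sets, leaving \<open>step\<close> as the only
  obligation; that is where vertex-extendability enters.\<close>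

lemma restored_induct:
  assumes H: "rgraph r H" and r: "r > 0"
    and hered: "hereditary \<HH>" and base: "(verts H, edges H - A) \<in> \<HH>"
    and step: "\<And>S x. x \<in> verts (restored H A B S) \<Longrightarrow>
      delete_vertex (restored H A B S) x \<in> \<HH> \<Longrightarrow> restored H A B S \<in> \<HH>"
  shows "H \<in> \<HH>"
proof -
  have "restored H A B S \<in> \<HH>" if "finite S" "S \<subseteq> verts H" for S
    using that
  proof (induction S)
    case empty
    then show ?case using hered base restored_empty unfolding hereditary_def by blast
  next
    case (insert x S)
    then have "restored H A B S \<in> \<HH>" by simp
    then have "delete_vertex (restored H A B (insert x S)) x \<in> \<HH>"
      using hered delete_vertex_restored_insert unfolding hereditary_def by blast
    moreover have "x \<in> verts (restored H A B (insert x S))"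
      using insert.prems by (simp add: restored_def)
    ultimately show ?case by (rule step[rotated])
  qed
  from this[of "verts H"] show ?thesis
    using H restored_verts[OF H r] by (simp add: rgraph_def)
qed

section \<open>From minimum degree to the number of copies\<close>

lemma min_degree_le:
  assumes "finite (verts H)" "v \<in> verts H"
  shows "min_degree Q H \<le> degree Q H v"
  unfolding min_degree_def using assms by (intro Min_le) auto

lemma min_degree_geI:
  assumes "finite (verts H)" "verts H \<noteq> {}" "\<And>v. v \<in> verts H \<Longrightarrow> t \<le> real (degree Q H v)"
  shows "t \<le> real (min_degree Q H)"
proof -
  have "min_degree Q H \<in> degree Q H ` verts H"
    unfolding min_degree_def using assms by (intro Min_in) auto
  then show ?thesis using assms(3) by auto
qed

text \<open>Sum the degree bound over all vertices and cancel \<open>card (verts Q)\<close> from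
  \<open>sum_degree\<close>.\<close>

lemma inj_count_ge_of_min_degree:
  assumes Q: "rgraph r Q" and H: "rgraph r H" and r: "r > 0" and n: "card (verts H) = n" "n > 0"
    and eps: "0 \<le> \<epsilon>"
    and deg: "real (min_degree Q H)
      \<ge> (1 - \<epsilon>) * (real (card (verts Q)) * real (inj_max r n Q \<F>) / real n)"
  shows "real (inj_count Q H) \<ge> (1 - \<epsilon>) * real (inj_max r n Q \<F>)"
proof (cases "verts Q = {}")
  \<comment> \<open>Here \<open>card (verts Q)\<close> is 0 and cannot be cancelled. The empty map,
    written as the constant \<open>undefined\<close>, is a copy in every graph, and no graph has
    more than one.\<close>
  case True
  then have "edges Q = {}" using Q r by (auto simp: rgraph_def)
  with True have "(\<lambda>_. undefined) \<in> inj_homs Q H" by (simp add: inj_homs_def homs_def)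
  then have "inj_count Q H > 0"
    using finite_inj_homs[OF Q H] by (auto simp: inj_count_def card_gt_0_iff)
  moreover have "inj_max r n Q \<F> \<le> 1"
    using inj_max_attained[OF Q, of n \<F>] inj_count_le_power[OF Q] True by force
  then have "(1 - \<epsilon>) * real (inj_max r n Q \<F>) \<le> 1"
    using eps by (cases "inj_max r n Q \<F>") auto
  ultimately show ?thesis by linarith
next
  case False
  then have q: "card (verts Q) > 0" using Q by (auto simp: rgraph_def card_gt_0_iff)
  have fV: "finite (verts H)" using H by (simp add: rgraph_def)
  let ?t = "(1 - \<epsilon>) * (real (card (verts Q)) * real (inj_max r n Q \<F>) / real n)"
  have "real n * ?t = (\<Sum>v\<in>verts H. ?t)" by (simp add: n)
  also have "\<dots> \<le> (\<Sum>v\<in>verts H. real (degree Q H v))"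
    using deg min_degree_le[OF fV, of _ Q] by (intro sum_mono) (meson of_nat_le_iff order_trans)
  also have "\<dots> = real (card (verts Q)) * real (inj_count Q H)"
    using sum_degree[OF Q H] by (metis of_nat_mult of_nat_sum)
  also have "real n * ?t = real (card (verts Q)) * ((1 - \<epsilon>) * real (inj_max r n Q \<F>))"
    using n by simp
  finally have "real (card (verts Q)) * ((1 - \<epsilon>) * real (inj_max r n Q \<F>))
      \<le> real (card (verts Q)) * real (inj_count Q H)" .
  then show ?thesis using q by simp
qed

section \<open>Choice of constants and comparison of thresholds\<close>

lemma ex_small_factor:
  fixes X Y a b :: real
  assumes "X \<ge> 0" "Y \<ge> 0" "a > 0" "b > 0"
  shows "\<exists>\<beta>>0. X * \<beta> \<le> a \<and> Y * \<beta> \<le> b"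
proof (intro exI conjI)
  \<comment> \<open>Adding 1 keeps the denominators positive when \<open>X\<close> or
    \<open>Y\<close> is 0.\<close>
  let ?\<beta> = "min (a / (X + 1)) (b / (Y + 1))"
  show "?\<beta> > 0" using assms by simp
  have "X * ?\<beta> \<le> X * (a / (X + 1))" using assms by (intro mult_left_mono) auto
  also have "\<dots> \<le> a" using assms by (simp add: field_simps)
  finally show "X * ?\<beta> \<le> a" .
  have "Y * ?\<beta> \<le> Y * (b / (Y + 1))" using assms by (intro mult_left_mono) auto
  also have "\<dots> \<le> b" using assms by (simp add: field_simps)
  finally show "Y * ?\<beta> \<le> b" .
qed

text \<open>The slack between \<open>1 - \<epsilon> / 8\<close> and \<open>1 - \<epsilon>\<close> absorbs both the error in
  \<open>inj_max r n Q \<F> \<approx> pi_inj r Q \<F> * n ^ q\<close> and a degree loss of relative size \<open>\<epsilon> / 2\<close>.\<close>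
lemma degree_threshold_transfer:
  fixes \<epsilon> p M\<^sub>n M\<^sub>m d d' :: real and q m n :: nat
  assumes eps: "0 < \<epsilon>" "\<epsilon> \<le> 1" and p: "p > 0" and m: "0 < m" "m \<le> n"
    and Mn: "(1 - \<epsilon> / 8) * p * real n ^ q \<le> M\<^sub>n"
    and Mm: "M\<^sub>m \<le> (1 + \<epsilon> / 8) * p * real m ^ q"
    and d: "(1 - \<epsilon>') * (real q * M\<^sub>n / real n) \<le> d" "\<epsilon>' \<le> \<epsilon> / 8"
    and d': "d \<le> d' + \<epsilon> / 2 * p * (real n ^ q / real n)" "0 \<le> d'"
  shows "(1 - \<epsilon>) * (real q * M\<^sub>m / real m) \<le> d'"
proof (cases q)
  case 0
  then show ?thesis using d' by simp
next
  case (Suc k)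
  \<comment> \<open>With \<open>k = q - 1\<close>, \<open>x\<close> is the common scale: both
    \<open>M\<^sub>n / n\<close> and \<open>M\<^sub>m / m\<close> are compared with it.\<close>
  define x where "x = p * real n ^ k"
  have n: "n > 0" using m by simp
  have x: "x > 0" using p n by (simp add: x_def)
  have "real m ^ k \<le> real n ^ k" using m by (intro power_mono) auto
  have "M\<^sub>m / real m \<le> (1 + \<epsilon> / 8) * p * real m ^ q / real m"
    using Mm m by (intro divide_right_mono) auto
  also have "\<dots> = (1 + \<epsilon> / 8) * p * real m ^ k" using m Suc by simp
  also have "\<dots> \<le> (1 + \<epsilon> / 8) * p * real n ^ k"
    using eps p \<open>real m ^ k \<le> real n ^ k\<close> by (intro mult_left_mono) auto
  finally have 1: "M\<^sub>m / real m \<le> (1 + \<epsilon> / 8) * x" by (simp add: x_def)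
  have "(1 - \<epsilon> / 8) * p * real n ^ q / real n \<le> M\<^sub>n / real n"
    using Mn n by (intro divide_right_mono) auto
  then have 2: "(1 - \<epsilon> / 8) * x \<le> M\<^sub>n / real n" using n Suc by (simp add: x_def)
  have "(1 - \<epsilon>) * (real q * M\<^sub>m / real m) \<le> real q * ((1 - \<epsilon>) * ((1 + \<epsilon> / 8) * x))"
    using mult_left_mono[OF 1, of "real q * (1 - \<epsilon>)"] eps by (simp add: mult_ac)
  \<comment> \<open>One factor \<open>1 - \<epsilon> / 8\<close> pays for the lower bound on
    \<open>M\<^sub>n\<close>, the other for the degree hypothesis on \<open>d\<close>.\<close>
  also have "\<dots> \<le> real q * ((1 - \<epsilon> / 8) * ((1 - \<epsilon> / 8) * x)) - real q * (\<epsilon> / 2 * x)"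
  proof -
    have "(1 - \<epsilon> / 8) * (1 - \<epsilon> / 8) - \<epsilon> / 2 - (1 - \<epsilon>) * (1 + \<epsilon> / 8) = \<epsilon> / 8 + 9 * \<epsilon>\<^sup>2 / 64"
      by (simp add: field_simps power2_eq_square)
    then have "(1 - \<epsilon>) * (1 + \<epsilon> / 8) \<le> (1 - \<epsilon> / 8) * (1 - \<epsilon> / 8) - \<epsilon> / 2"
      using eps by (smt (verit) divide_nonneg_pos zero_le_power2)
    from mult_left_mono[OF mult_right_mono[OF this, of x], of "real q"] x
    show ?thesis by (simp only: left_diff_distrib right_diff_distrib mult.assoc)
  qed
  also have "\<dots> \<le> d - \<epsilon> / 2 * x"
  proof -
    have "(1 - \<epsilon> / 8) * ((1 - \<epsilon> / 8) * x) \<le> (1 - \<epsilon> / 8) * (M\<^sub>n / real n)"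
      using 2 eps by (intro mult_left_mono) auto
    also have "\<dots> \<le> (1 - \<epsilon>') * (M\<^sub>n / real n)"
    proof (rule mult_right_mono)
      have "0 \<le> (1 - \<epsilon> / 8) * x" using eps x by simp
      then show "0 \<le> M\<^sub>n / real n" using 2 by linarith
    qed (use d in simp)
    finally have "real q * ((1 - \<epsilon> / 8) * ((1 - \<epsilon> / 8) * x)) \<le> real q * ((1 - \<epsilon>') * (M\<^sub>n / real n))"
      by (intro mult_left_mono) auto
    also have "\<dots> \<le> d" using d by (simp add: mult_ac)
    finally have "real q * ((1 - \<epsilon> / 8) * ((1 - \<epsilon> / 8) * x)) \<le> d" .
    \<comment> \<open>As \<open>q\<close> is at least 1, the reserve
      \<open>q * (\<epsilon> / 2 * x)\<close> covers the actual loss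
      \<open>\<epsilon> / 2 * x\<close>.\<close>
    moreover have "1 * (\<epsilon> / 2 * x) \<le> real q * (\<epsilon> / 2 * x)"
      using Suc eps x by (intro mult_right_mono) auto
    ultimately show ?thesis by linarith
  qed
  also have "\<dots> \<le> d'" using d' n Suc by (simp add: x_def mult_ac)
  finally show ?thesis .
qed

section \<open>Assembling the argument\<close>

theorem theorem4p10:
  fixes r :: nat and Q :: hypergraph and \<F> \<HH> :: "hypergraph set"
  assumes "r \<ge> 2"
    and "rgraph r Q"
    and "\<forall>F\<in>\<F>. rgraph r F"
    and "pi_inj r Q \<F> > 0"
    and "\<forall>H\<in>\<HH>. rgraph r H \<and> free \<F> H"
    and "hereditary \<HH>"
    and "edge_stable r Q \<F> \<HH>"
    and "vertex_extendable r Q \<F> \<HH>"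
  shows "degree_stable r Q \<F> \<HH>"
proof -
  note Q = \<open>rgraph r Q\<close>
  define p where "p = pi_inj r Q \<F>"
  define q where "q = card (verts Q)"
  define c where "c = real (card (edges Q)) * real r ^ r"
  have p: "p > 0" and r: "r > 0" and c: "c \<ge> 0" using assms by (auto simp: p_def c_def)
  obtain \<epsilon>\<^sub>1 N\<^sub>1 where \<epsilon>\<^sub>1: "\<epsilon>\<^sub>1 > 0" and ext: "\<And>H v. card (verts H) \<ge> N\<^sub>1 \<Longrightarrow> rgraph r H \<Longrightarrow>
      free \<F> H \<Longrightarrow> real (min_degree Q H) \<ge>
        (1 - \<epsilon>\<^sub>1) * (real q * real (inj_max r (card (verts H)) Q \<F>) / real (card (verts H))) \<Longrightarrow>
      v \<in> verts H \<Longrightarrow> delete_vertex H v \<in> \<HH> \<Longrightarrow> H \<in> \<HH>"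
    using assms(8) unfolding vertex_extendable_def q_def by metis
  \<comment> \<open>The cap at 1 keeps \<open>1 - \<epsilon>\<close> nonnegative, as
    \<open>degree_threshold_transfer\<close> requires.\<close>
  define \<epsilon> where "\<epsilon> = min \<epsilon>\<^sub>1 1"
  have \<epsilon>: "0 < \<epsilon>" "\<epsilon> \<le> 1" "\<epsilon> \<le> \<epsilon>\<^sub>1" using \<epsilon>\<^sub>1 by (auto simp: \<epsilon>_def)
  \<comment> \<open>First \<open>\<eta>\<close>, the threshold for bad vertices, then
    \<open>\<beta>\<close>, which must be small relative to \<open>\<eta>\<close> because
    \<open>B\<close> has size up to \<open>r * \<beta> / \<eta> * n\<close>. Each choice uses half
    of the allowed loss \<open>\<epsilon> / 2 * p\<close>; the bound 1 / 2 keeps at least half of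
    the vertices at every stage.\<close>
  obtain \<eta> where \<eta>: "\<eta> > 0" "c * \<eta> \<le> \<epsilon> / 4 * p"
    using ex_small_factor[of c 0 "\<epsilon> / 4 * p" 1] c \<epsilon> p by auto
  obtain \<beta> where \<beta>: "\<beta> > 0"
      "(real q ^ 2 * (real r / \<eta>) + c * real q) * \<beta> \<le> \<epsilon> / 4 * p" "real r / \<eta> * \<beta> \<le> 1 / 2"
    using ex_small_factor[of "real q ^ 2 * (real r / \<eta>) + c * real q" "real r / \<eta>" "\<epsilon> / 4 * p" "1 / 2"]
      c \<epsilon> p \<eta> by auto
  define \<kappa> where "\<kappa> = real r / \<eta> * \<beta>"
  have loss: "real q ^ 2 * \<kappa> + c * \<eta> + c * real q * \<beta> \<le> \<epsilon> / 2 * p"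
  proof -
    have "(real q ^ 2 * (real r / \<eta>) + c * real q) * \<beta> = real q ^ 2 * \<kappa> + c * real q * \<beta>"
      by (simp add: \<kappa>_def distrib_right)
    then show ?thesis using \<beta>(2) \<eta>(2) by linarith
  qed
  obtain \<delta> N\<^sub>2 where \<delta>: "\<delta> > 0" and stab: "\<And>H. card (verts H) \<ge> N\<^sub>2 \<Longrightarrow> rgraph r H \<Longrightarrow>
      free \<F> H \<Longrightarrow> real (inj_count Q H) \<ge> (1 - \<delta>) * real (inj_max r (card (verts H)) Q \<F>) \<Longrightarrow>
      \<exists>A \<subseteq> edges H. real (card A) \<le> \<beta> * real (card (verts H)) ^ r \<and> (verts H, edges H - A) \<in> \<HH>"
    using assms(7) \<beta>(1) unfolding edge_stable_def by metis
  obtain N\<^sub>3 where N\<^sub>3: "\<And>n. n \<ge> N\<^sub>3 \<Longrightarrow> (1 - \<epsilon> / 8) * p * real n ^ q \<le> real (inj_max r n Q \<F>)"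
      "\<And>n. n \<ge> N\<^sub>3 \<Longrightarrow> real (inj_max r n Q \<F>) \<le> (1 + \<epsilon> / 8) * p * real n ^ q"
    using inj_max_bounds[OF Q assms(4), of "\<epsilon> / 8"] \<epsilon> unfolding p_def q_def by auto
  \<comment> \<open>Edge-stability is applied to \<open>H\<close> itself, but
    \<open>N\<^sub>1\<close> and \<open>N\<^sub>3\<close> must also be reached by stages with only
    \<open>n / 2\<close> vertices, hence the factor 2.\<close>
  define N where "N = N\<^sub>2 + 2 * (N\<^sub>1 + N\<^sub>3 + 1)"
  \<comment> \<open>The bound \<open>\<delta>\<close> serves edge-stability,
    \<open>\<epsilon> / 8\<close> the transfer of the degree threshold.\<close>
  define \<epsilon>' where "\<epsilon>' = min (\<epsilon> / 8) \<delta>"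
  have \<epsilon>': "\<epsilon>' > 0" using \<epsilon> \<delta> by (simp add: \<epsilon>'_def)
  have "H \<in> \<HH>" if n: "card (verts H) = n" "n \<ge> N" and H: "rgraph r H" "free \<F> H"
    and deg: "real (min_degree Q H) \<ge> (1 - \<epsilon>') * (real q * real (inj_max r n Q \<F>) / real n)"
    for n H
  proof -
    have n0: "n > 0" using n by (simp add: N_def)
    have fV: "finite (verts H)" using H by (simp add: rgraph_def)
    have "(1 - \<epsilon>') * real (inj_max r n Q \<F>) \<le> real (inj_count Q H)"
      using inj_count_ge_of_min_degree[OF Q H(1) r n(1) n0] deg \<epsilon>' by (simp add: q_def)
    moreover have "(1 - \<delta>) * real (inj_max r n Q \<F>) \<le> (1 - \<epsilon>') * real (inj_max r n Q \<F>)"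
      by (intro mult_right_mono) (auto simp: \<epsilon>'_def)
    ultimately obtain A where A: "A \<subseteq> edges H" "real (card A) \<le> \<beta> * real n ^ r"
        "(verts H, edges H - A) \<in> \<HH>"
      using stab[of H] n H by (auto simp: N_def)
    define B where "B = {v \<in> verts H. \<eta> * real n ^ r / real n < real (card {a \<in> A. v \<in> a})}"
    have t: "\<eta> * real n ^ r / real n > 0" using \<eta> n0 by simp
    have "real (card B) * (\<eta> * real n ^ r / real n) \<le> real r * real (card A)"
      unfolding B_def using A(1) H(1)
      by (intro few_vertices_of_large_degree fV t) (auto simp: rgraph_def)
    also have "\<dots> \<le> real r * (\<beta> * real n ^ r)" using A(2) by (intro mult_left_mono) auto
    also have "\<dots> = \<kappa> * real n * (\<eta> * real n ^ r / real n)"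
      using \<eta> n0 by (simp add: \<kappa>_def field_simps)
    finally have cB: "real (card B) \<le> \<kappa> * real n" using t by (rule mult_right_le_imp_le)
    have "\<kappa> * real n \<le> 1 / 2 * real n" using \<beta>(3) by (intro mult_right_mono) (auto simp: \<kappa>_def)
    then have halfB: "2 * card B \<le> n" using cB by linarith
    show ?thesis
    proof (rule restored_induct[OF H(1) r assms(6) A(3)])
      fix S x
      let ?G = "restored H A B S"
      assume x: "x \<in> verts ?G" and del: "delete_vertex ?G x \<in> \<HH>"
      let ?m = "card (verts ?G)"
      have "card (verts H) - card B \<le> card (verts H - B)" by (rule diff_card_le_card_Diff) (simp add: B_def fV)
      also have "\<dots> \<le> ?m" using fV by (intro card_mono) (auto simp: restored_def)
      finally have "2 * ?m \<ge> n" using halfB n by linarith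
      then have m: "?m \<ge> N\<^sub>1" "?m \<ge> N\<^sub>3" "?m > 0" using n by (auto simp: N_def)
      have mn: "?m \<le> n" using fV n by (auto simp: restored_def intro: card_mono)
      have G: "rgraph r ?G" "free \<F> ?G"
        using rgraph_subgraph[OF H(1)] free_subgraph[OF H(2)] subgraph_restored by blast+
      have "(1 - \<epsilon>) * (real q * real (inj_max r ?m Q \<F>) / real ?m) \<le> real (min_degree Q ?G)"
      proof (rule min_degree_geI)
        fix w assume w: "w \<in> verts ?G"
        then have wH: "w \<in> verts H" by (simp add: restored_def)
        have "real (degree Q H w) \<le> real (degree Q ?G w)
            + (real q ^ 2 * \<kappa> + c * \<eta> + c * real q * \<beta>) * (real n ^ q / real n)"
          unfolding q_def c_def n(1)[symmetric]
        proof (rule degree_restored_ge[OF Q H(1) A(1) w])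
          show "real (card (B \<inter> verts H)) \<le> \<kappa> * real (card (verts H))"
            using cB n by (simp add: B_def Int_absorb2)
        qed (use A(2) \<eta> n in \<open>auto simp: B_def\<close>)
        also have "\<dots> \<le> real (degree Q ?G w) + \<epsilon> / 2 * p * (real n ^ q / real n)"
          using loss by (intro add_left_mono mult_right_mono) auto
        finally have l: "real (degree Q H w)
            \<le> real (degree Q ?G w) + \<epsilon> / 2 * p * (real n ^ q / real n)" .
        have d: "(1 - \<epsilon>') * (real q * real (inj_max r n Q \<F>) / real n) \<le> real (degree Q H w)"
          using deg min_degree_le[OF fV wH, of Q] by linarith
        have "n \<ge> N\<^sub>3" using n by (simp add: N_def)
        show "(1 - \<epsilon>) * (real q * real (inj_max r ?m Q \<F>) / real ?m) \<le> real (degree Q ?G w)"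
          by (rule degree_threshold_transfer[OF \<epsilon>(1,2) p m(3) mn N\<^sub>3(1)[OF \<open>n \<ge> N\<^sub>3\<close>] N\<^sub>3(2)[OF m(2)] d _ l])
             (auto simp: \<epsilon>'_def)
      qed (use G x in \<open>auto simp: rgraph_def\<close>)
      moreover have "(1 - \<epsilon>\<^sub>1) * (real q * real (inj_max r ?m Q \<F>) / real ?m)
          \<le> (1 - \<epsilon>) * (real q * real (inj_max r ?m Q \<F>) / real ?m)"
        using \<epsilon>(3) by (intro mult_right_mono) auto
      ultimately show "?G \<in> \<HH>"
        by (intro ext[OF m(1) G _ x del]) linarith
    qed
  qed
  then show ?thesis
    unfolding degree_stable_def q_def[symmetric] using \<epsilon>' by blast
qed

end
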